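(* For any $x\in\mathbb{Q}$, \[ \gamma_{\mathcal{A}}^{\mathrm{M}}(x)=\gamma_{\mathcal{A}}^{\mathrm{W}}+\ell_{\mathcal{A}}(x+2)-\ell_{\mathcal{A}}(x+1)+\delta_{-1}(x)-1\quad\text{in }\mathcal{A}. \] In particular, $\gamma_{\mathcal{A}}^{\mathrm{M}}(-1)=\gamma_{\mathcal{A}}^{\mathrm{W}}$.
   Context: $\mathcal{A}\coloneqq\big(\prod_{p\text{ prime}}\mathbb{Z}/p\mathbb{Z}\big)/\big(\bigoplus_{p\text{ prime}}\mathbb{Z}/p\mathbb{Z}\big)$, a $\mathbb{Q}$-algebra via the diagonal embedding of $\mathbb{Q}$ (for the finitely many primes dividing a denominator, the $p$-component is assigned arbitrarily). Gregory polynomials $G_n(x)\in\mathbb{Q}[x]$ are defined by $\frac{t(1+t)^x}{\log(1+t)}=\sum_{n\ge0}G_n(x)t^n$. Define $\gamma_{\mathcal{A}}^{\mathrm{M}}(x)\coloneqq\big(\sum_{n=1}^{p-2}\frac{(-1)^{n-1}G_n(x)}{n}\bmod p\big)_p$, $\gamma_{\mathcal{A}}^{\mathrm{W}}\coloneqq\big(\frac{(p-1)!+1}{p}\bmod p\big)_p$, and for $x\in\mathbb{Q}$, $\ell_{\mathcal{A}}(x)\coloneqq\big(\frac{x^p-x}{p}\bmod p\big)_p$ (i.e. $x$ times the Fermat quotient $q_p(x)=\frac{x^{p-1}-1}{p}$; in particular $\ell_{\mathcal{A}}(0)=0$). $\delta_{-1}$ is the indicator function of $\{-1\}$. *)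

theory Defs
  imports
    "HOL-Library.Indicator_Function"
    "HOL-Algebra.QuotRing"
    "HOL-Number_Theory.Residues"
    "HOL-Number_Theory.Modular_Inverse"
    "HOL-Computational_Algebra.Computational_Algebra"
begin

section \<open>The ring \<open>\<A>\<close>\<close>

definition prime_prod :: "(nat \<Rightarrow> int) ring" where
  "prime_prod =
    \<lparr>carrier = (\<Pi>\<^sub>E p\<in>{p. prime p}. carrier (residue_ring (int p))),
     monoid.mult = (\<lambda>f g. \<lambda>p\<in>{p. prime p}. f p \<otimes>\<^bsub>residue_ring (int p)\<^esub> g p),
     one = (\<lambda>p\<in>{p. prime p}. \<one>\<^bsub>residue_ring (int p)\<^esub>),
     zero = (\<lambda>p\<in>{p. prime p}. \<zero>\<^bsub>residue_ring (int p)\<^esub>),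
     add = (\<lambda>f g. \<lambda>p\<in>{p. prime p}. f p \<oplus>\<^bsub>residue_ring (int p)\<^esub> g p)\<rparr>"

definition prime_sum :: "(nat \<Rightarrow> int) set" where
  "prime_sum = {f \<in> carrier prime_prod.
     finite {p. prime p \<and> f p \<noteq> \<zero>\<^bsub>residue_ring (int p)\<^esub>}}"

definition \<A> :: "(nat \<Rightarrow> int) set ring" where
  "\<A> = prime_prod Quot prime_sum"

lemma residue_ring_sel:
  "carrier (residue_ring m) = {0..m - 1}"
  "x \<otimes>\<^bsub>residue_ring m\<^esub> y = (x * y) mod m"
  "x \<oplus>\<^bsub>residue_ring m\<^esub> y = (x + y) mod m"
  "\<one>\<^bsub>residue_ring m\<^esub> = 1"
  "\<zero>\<^bsub>residue_ring m\<^esub> = 0"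
  by (simp_all add: residue_ring_def)

lemma cring_residue_ring_prime: "prime p \<Longrightarrow> cring (residue_ring (int p))"
  by (rule residues.cring) (auto simp: residues_def dest: prime_gt_1_nat)

lemma prime_prod_sel:
  "carrier prime_prod = (\<Pi>\<^sub>E p\<in>{p. prime p}. {0..<int p})"
  "f \<otimes>\<^bsub>prime_prod\<^esub> g = (\<lambda>p\<in>{p. prime p}. (f p * g p) mod int p)"
  "f \<oplus>\<^bsub>prime_prod\<^esub> g = (\<lambda>p\<in>{p. prime p}. (f p + g p) mod int p)"
  "\<one>\<^bsub>prime_prod\<^esub> = (\<lambda>p\<in>{p. prime p}. 1)"
  "\<zero>\<^bsub>prime_prod\<^esub> = (\<lambda>p\<in>{p. prime p}. 0)"
  by (simp_all add: prime_prod_def residue_ring_sel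
      flip: atLeastLessThanPlusOne_atLeastAtMost_int)

lemma mod_in_prime_prod: "(\<lambda>p\<in>{p. prime p}. h p mod int p) \<in> carrier prime_prod"
  by (auto simp: prime_prod_sel prime_gt_0_nat)

lemma cring_prime_prod: "cring prime_prod"
proof (rule cringI)
  have restr: "(\<lambda>p\<in>{p. prime p}. g p) = f" if "\<And>p. prime p \<Longrightarrow> g p = f p" "f \<in> carrier prime_prod" for f g
    using that by (auto simp: prime_prod_sel PiE_iff extensional_def fun_eq_iff)
  have mod_id: "f p mod int p = f p" if "f \<in> carrier prime_prod" "prime p" for f p
    using that by (auto simp: prime_prod_sel PiE_iff)
  show "abelian_group prime_prod"
  proof (rule abelian_groupI)
    fix f g h assume fgh: "f \<in> carrier prime_prod" "g \<in> carrier prime_prod" "h \<in> carrier prime_prod"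
    show "f \<oplus>\<^bsub>prime_prod\<^esub> g \<in> carrier prime_prod"
      unfolding prime_prod_sel(3) by (rule mod_in_prime_prod)
    show "f \<oplus>\<^bsub>prime_prod\<^esub> g = g \<oplus>\<^bsub>prime_prod\<^esub> f"
      by (simp add: prime_prod_sel add.commute)
    show "f \<oplus>\<^bsub>prime_prod\<^esub> g \<oplus>\<^bsub>prime_prod\<^esub> h = f \<oplus>\<^bsub>prime_prod\<^esub> (g \<oplus>\<^bsub>prime_prod\<^esub> h)"
      by (auto simp: prime_prod_sel mod_simps add.assoc intro!: restrict_ext)
  next
    show "\<zero>\<^bsub>prime_prod\<^esub> \<in> carrier prime_prod"
      using mod_in_prime_prod[of "\<lambda>_. 0"] by (simp add: prime_prod_sel)
  next
    fix f assume f: "f \<in> carrier prime_prod"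
    show "\<zero>\<^bsub>prime_prod\<^esub> \<oplus>\<^bsub>prime_prod\<^esub> f = f"
      unfolding prime_prod_sel(3) by (rule restr) (use f in \<open>simp_all add: mod_id prime_prod_sel(5)\<close>)
    have "(\<lambda>p\<in>{p. prime p}. (- f p) mod int p) \<oplus>\<^bsub>prime_prod\<^esub> f = \<zero>\<^bsub>prime_prod\<^esub>"
      by (auto simp: prime_prod_sel mod_simps)
    then show "\<exists>g\<in>carrier prime_prod. g \<oplus>\<^bsub>prime_prod\<^esub> f = \<zero>\<^bsub>prime_prod\<^esub>"
      using mod_in_prime_prod[of "\<lambda>p. - f p"] by (rule bexI)
  qed
  show "comm_monoid prime_prod"
  proof (rule comm_monoidI)
    fix f g h assume fgh: "f \<in> carrier prime_prod" "g \<in> carrier prime_prod" "h \<in> carrier prime_prod"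
    show "f \<otimes>\<^bsub>prime_prod\<^esub> g \<in> carrier prime_prod"
      unfolding prime_prod_sel(2) by (rule mod_in_prime_prod)
    show "f \<otimes>\<^bsub>prime_prod\<^esub> g = g \<otimes>\<^bsub>prime_prod\<^esub> f"
      by (simp add: prime_prod_sel mult.commute)
    show "f \<otimes>\<^bsub>prime_prod\<^esub> g \<otimes>\<^bsub>prime_prod\<^esub> h = f \<otimes>\<^bsub>prime_prod\<^esub> (g \<otimes>\<^bsub>prime_prod\<^esub> h)"
      by (auto simp: prime_prod_sel mod_simps mult.assoc intro!: restrict_ext)
  next
    show "\<one>\<^bsub>prime_prod\<^esub> \<in> carrier prime_prod"
      by (auto simp: prime_prod_sel dest: prime_gt_1_nat)
  next
    fix f assume f: "f \<in> carrier prime_prod"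
    show "\<one>\<^bsub>prime_prod\<^esub> \<otimes>\<^bsub>prime_prod\<^esub> f = f"
      unfolding prime_prod_sel(2) by (rule restr) (use f in \<open>simp_all add: mod_id prime_prod_sel(4)\<close>)
  qed
  fix f g h assume fgh: "f \<in> carrier prime_prod" "g \<in> carrier prime_prod" "h \<in> carrier prime_prod"
  show "(f \<oplus>\<^bsub>prime_prod\<^esub> g) \<otimes>\<^bsub>prime_prod\<^esub> h = f \<otimes>\<^bsub>prime_prod\<^esub> h \<oplus>\<^bsub>prime_prod\<^esub> g \<otimes>\<^bsub>prime_prod\<^esub> h"
    by (auto simp: prime_prod_sel mod_simps distrib_right intro!: restrict_ext)
qed

lemma prime_sum_iff:
  "f \<in> prime_sum \<longleftrightarrow> f \<in> carrier prime_prod \<and> finite {p. prime p \<and> f p \<noteq> 0}"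
  by (simp add: prime_sum_def residue_ring_sel)

lemma a_inv_prime_prod:
  assumes "f \<in> carrier prime_prod"
  shows "\<ominus>\<^bsub>prime_prod\<^esub> f = (\<lambda>p\<in>{p. prime p}. (- f p) mod int p)"
proof -
  interpret cring prime_prod by (rule cring_prime_prod)
  show ?thesis
    by (rule minus_equality[OF _ assms])
       (use mod_in_prime_prod in \<open>auto simp: prime_prod_sel mod_simps\<close>)
qed

lemma ideal_prime_sum: "ideal prime_sum prime_prod"
proof -
  interpret cring prime_prod by (rule cring_prime_prod)
  show ?thesis
  proof (rule idealI[OF ring_axioms])
    show "subgroup prime_sum (add_monoid prime_prod)"
    proof
      show "prime_sum \<subseteq> carrier (add_monoid prime_prod)" by (auto simp: prime_sum_iff)
    next
      fix f g assume fg: "f \<in> prime_sum" "g \<in> prime_sum"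
      then have "finite ({p. prime p \<and> f p \<noteq> 0} \<union> {p. prime p \<and> g p \<noteq> 0})"
        by (auto simp: prime_sum_iff)
      then have "finite {p. prime p \<and> (f \<oplus>\<^bsub>prime_prod\<^esub> g) p \<noteq> 0}"
        by (rule rev_finite_subset) (auto simp: prime_prod_sel)
      with fg show "f \<otimes>\<^bsub>add_monoid prime_prod\<^esub> g \<in> prime_sum"
        by (simp add: prime_sum_iff)
    next
      show "\<one>\<^bsub>add_monoid prime_prod\<^esub> \<in> prime_sum"
        using zero_closed by (simp add: prime_sum_iff) (simp add: prime_prod_sel)
    next
      fix f assume f: "f \<in> prime_sum"
      then have fin: "finite {p. prime p \<and> f p \<noteq> 0}" and fc: "f \<in> carrier prime_prod"
        by (auto simp: prime_sum_iff)
      from fin have "finite {p. prime p \<and> (\<ominus>\<^bsub>prime_prod\<^esub> f) p \<noteq> 0}"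
        by (rule rev_finite_subset) (auto simp: a_inv_prime_prod[OF fc])
      with fc show "inv\<^bsub>add_monoid prime_prod\<^esub> f \<in> prime_sum"
        unfolding a_inv_def[symmetric] by (simp add: prime_sum_iff)
    qed
    fix f g assume f: "f \<in> prime_sum" and g: "g \<in> carrier prime_prod"
    then have fin: "finite {p. prime p \<and> f p \<noteq> 0}" and fc: "f \<in> carrier prime_prod"
      by (auto simp: prime_sum_iff)
    from fin have "finite {p. prime p \<and> (g \<otimes>\<^bsub>prime_prod\<^esub> f) p \<noteq> 0}"
      by (rule rev_finite_subset) (auto simp: prime_prod_sel)
    with fc g show *: "g \<otimes>\<^bsub>prime_prod\<^esub> f \<in> prime_sum"
      by (simp add: prime_sum_iff)
    with fc g show "f \<otimes>\<^bsub>prime_prod\<^esub> g \<in> prime_sum"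
      by (simp add: m_comm)
  qed
qed

lemma cring_A: "cring \<A>"
  unfolding \<A>_def by (rule ideal.quotient_is_cring[OF ideal_prime_sum cring_prime_prod])

section \<open>Elements of \<open>\<A>\<close> given by sequences of rational numbers\<close>

text \<open>
  If \<open>p\<close> divides the denominator of \<open>r\<close>, then \<open>rat_mod p r\<close> is the junk value \<open>0\<close>, because
  \<^const>\<open>modular_inverse\<close> is \<open>0\<close> on arguments that are not invertible.
\<close>
definition rat_mod :: "nat \<Rightarrow> rat \<Rightarrow> int" where
  "rat_mod p r =
     (fst (quotient_of r) * modular_inverse (int p) (snd (quotient_of r))) mod int p"

text \<open>
  \<open>A_of r\<close> is the class of \<open>(r p mod p)\<^sub>p\<close>; it is meaningful if \<open>r p\<close> is \<open>p\<close>-integral for all but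
  finitely many primes \<open>p\<close>.
\<close>
definition A_of :: "(nat \<Rightarrow> rat) \<Rightarrow> (nat \<Rightarrow> int) set" where
  "A_of r = prime_sum +>\<^bsub>prime_prod\<^esub> (\<lambda>p\<in>{p. prime p}. rat_mod p (r p))"

definition A_of_rat :: "rat \<Rightarrow> (nat \<Rightarrow> int) set" where
  "A_of_rat r = A_of (\<lambda>p. r)"

lemma rat_mod_unique:
  assumes p: "prime p" and b: "\<not> int p dvd b" and c: "0 \<le> c" "c < int p" "[c * b = a] (mod int p)"
  shows "rat_mod p (of_int a / of_int b) = c"
proof -
  have b0: "b \<noteq> 0" using b by auto
  obtain n d where nd: "quotient_of (of_int a / of_int b) = (n, d)" by fastforce
  have d: "d > 0" and cop: "coprime n d"
    and eq: "of_int a / of_int b = (of_int n / of_int d :: rat)"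
    using quotient_of_denom_pos[OF nd] quotient_of_coprime[OF nd] quotient_of_div[OF nd] by auto
  from eq have "(of_int (a * d) :: rat) = of_int (n * b)"
    using b0 d by (simp add: field_simps)
  then have ad: "a * d = n * b" by (simp only: of_int_eq_iff)
  have "d dvd n * b" using ad by (metis dvd_triv_right)
  then have "d dvd b" using cop by (simp add: coprime_commute coprime_dvd_mult_right_iff)
  then have pd: "\<not> int p dvd d" using b dvd_trans by blast
  have cd: "coprime d (int p)" and cb: "coprime b (int p)"
    using p pd b by (metis coprime_commute prime_imp_coprime prime_nat_int_transfer)+
  let ?i = "modular_inverse (int p) d"
  have "[n * ?i * b = a * (d * ?i)] (mod int p)"
  proof -
    have "n * ?i * b = (n * b) * ?i" by (simp only: mult_ac)
    also have "\<dots> = a * (d * ?i)" unfolding ad[symmetric] by (simp only: mult_ac)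
    finally show ?thesis by (simp only: cong_refl)
  qed
  also have "[a * (d * ?i) = a * 1] (mod int p)"
    by (intro cong_mult cong_refl cong_modular_inverse1 cd)
  also have "[a * 1 = c * b] (mod int p)" using c(3) by (simp add: cong_sym)
  finally have "[n * ?i = c] (mod int p)" using cong_mult_rcancel[OF cb] by blast
  then show ?thesis
    using c nd by (simp add: rat_mod_def cong_def)
qed

lemma A_of_eq_iff:
  "A_of r = A_of s \<longleftrightarrow> finite {p. prime p \<and> rat_mod p (r p) \<noteq> rat_mod p (s p)}"
proof -
  interpret ideal prime_sum prime_prod by (rule ideal_prime_sum)
  define f where "f = (\<lambda>p\<in>{p. prime p}. rat_mod p (r p))"
  define g where "g = (\<lambda>p\<in>{p. prime p}. rat_mod p (s p))"
  have f: "f \<in> carrier prime_prod" and g: "g \<in> carrier prime_prod"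
    unfolding f_def g_def rat_mod_def by (rule mod_in_prime_prod)+
  have "A_of r = A_of s \<longleftrightarrow> f \<ominus>\<^bsub>prime_prod\<^esub> g \<in> prime_sum"
    unfolding A_of_def f_def[symmetric] g_def[symmetric]
    by (rule quotient_eq_iff_same_a_r_cos[OF ideal_prime_sum f g, symmetric])
  also have "\<dots> \<longleftrightarrow> finite {p. prime p \<and> (f \<ominus>\<^bsub>prime_prod\<^esub> g) p \<noteq> 0}"
    using minus_closed[OF f g] by (simp only: prime_sum_iff simp_thms)
  also have "{p. prime p \<and> (f \<ominus>\<^bsub>prime_prod\<^esub> g) p \<noteq> 0}
           = {p. prime p \<and> rat_mod p (r p) \<noteq> rat_mod p (s p)}"
  proof (rule Collect_cong, rule conj_cong[OF refl])
    fix p :: nat assume p: "prime p"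
    have "(f \<ominus>\<^bsub>prime_prod\<^esub> g) p = (rat_mod p (r p) - rat_mod p (s p)) mod int p"
      using p unfolding a_minus_def a_inv_prime_prod[OF g]
      by (simp add: prime_prod_sel f_def g_def mod_simps)
    moreover have "rat_mod p q mod int p = rat_mod p q" for q
      by (simp add: rat_mod_def)
    ultimately show "(f \<ominus>\<^bsub>prime_prod\<^esub> g) p \<noteq> 0 \<longleftrightarrow> rat_mod p (r p) \<noteq> rat_mod p (s p)"
      by (metis mod_eq_dvd_iff dvd_eq_mod_eq_0)
  qed
  finally show ?thesis .
qed

section \<open>Gregory polynomials\<close>

text \<open>
  The division by \<open>log (1 + t)\<close> happens in \<open>\<rat>[[t]]\<close>, because series over \<open>\<rat>[x]\<close> have no division
  in the library. Likewise \<^const>\<open>fps_binomial\<close> is restricted to coefficient fields, so the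
  coefficients \<open>x (x - 1) \<dots> (x - n + 1) / n!\<close> of \<open>(1 + t)\<^sup>x\<close> are written out.
\<close>
definition const_fps :: "rat fps \<Rightarrow> rat poly fps" where
  "const_fps f = Abs_fps (\<lambda>n. [:fps_nth f n:])"

definition one_plus_t_powr_x :: "rat poly fps" where
  "one_plus_t_powr_x =
     Abs_fps (\<lambda>n. smult (1 / fact n) (\<Prod>i = 0..<n. [:0, 1:] - of_nat i))"

definition gregory_poly :: "nat \<Rightarrow> rat poly" where
  "gregory_poly n = fps_nth (const_fps (fps_X / fps_ln 1) * one_plus_t_powr_x) n"

lemma const_fps_mult: "const_fps (f * g) = const_fps f * const_fps g"
proof (rule fps_ext)
  fix n
  have s: "[:sum h A:] = (\<Sum>i\<in>A. [:h i:])" for h :: "nat \<Rightarrow> rat" and A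
    by (rule poly_eqI) (simp add: coeff_sum coeff_pCons split: nat.splits)
  show "fps_nth (const_fps (f * g)) n = fps_nth (const_fps f * const_fps g) n"
    by (simp add: const_fps_def fps_mult_nth s mult.commute)
qed

lemma fps_X_div_fps_ln: "(fps_X / fps_ln 1) * fps_ln 1 = (fps_X :: rat fps)"
proof -
  have nz: "(fps_ln 1 :: rat fps) \<noteq> 0"
    by (auto simp: fps_eq_iff fps_ln_nth intro!: exI[of _ 1])
  have "subdegree (fps_ln 1 :: rat fps) \<le> 1"
    by (rule subdegree_leI) (simp add: fps_ln_nth)
  then have "(fps_ln 1 :: rat fps) dvd fps_X"
    using nz by (simp add: fps_dvd_iff)
  then show ?thesis by simp
qed

lemma gregory_poly_gf:
  "Abs_fps gregory_poly * const_fps (fps_ln 1) = fps_X * one_plus_t_powr_x"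
proof -
  have 1: "const_fps (fps_X / fps_ln 1) * const_fps (fps_ln 1) = fps_X"
    unfolding const_fps_mult[symmetric] fps_X_div_fps_ln
    by (rule fps_ext) (simp add: const_fps_def fps_X_def one_pCons)
  have "Abs_fps gregory_poly = const_fps (fps_X / fps_ln 1) * one_plus_t_powr_x"
    by (rule fps_ext) (simp add: gregory_poly_def)
  then have "Abs_fps gregory_poly * const_fps (fps_ln 1) =
      (const_fps (fps_X / fps_ln 1) * const_fps (fps_ln 1)) * one_plus_t_powr_x"
    by (simp only: mult_ac)
  then show ?thesis by (simp only: 1)
qed

lemma poly_one_plus_t_powr_x: "poly (fps_nth one_plus_t_powr_x n) x = x gchoose n"
  by (simp add: one_plus_t_powr_x_def gbinomial_prod_rev poly_prod of_nat_poly)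

lemma poly_gregory_poly:
  "poly (gregory_poly n) x = fps_nth (fps_X / fps_ln 1 * fps_binomial x) n"
  by (simp add: gregory_poly_def fps_mult_nth const_fps_def poly_sum poly_one_plus_t_powr_x)

section \<open>Analogues of Euler's constant and of the logarithm\<close>

definition gamma_M :: "rat \<Rightarrow> (nat \<Rightarrow> int) set" where
  "gamma_M x = A_of (\<lambda>p. \<Sum>n=1..p-2. (-1) ^ (n - 1) * poly (gregory_poly n) x / of_nat n)"

definition gamma_W :: "(nat \<Rightarrow> int) set" where
  "gamma_W = A_of (\<lambda>p. (fact (p - 1) + 1) / of_nat p)"

definition ell_A :: "rat \<Rightarrow> (nat \<Rightarrow> int) set" where
  "ell_A x = A_of (\<lambda>p. (x ^ p - x) / of_nat p)"

end

theory Submission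
  imports Defs
begin

text \<open>
  Comparing coefficients of \<open>t\<^sup>p\<close> in \<open>(\<Sum>n. G\<^sub>n(x) t\<^sup>n) log (1 + t) = t (1 + t)\<^sup>x\<close> gives
  \<open>\<Sum>n<p. (-1)\<^sup>p\<^sup>-\<^sup>n\<^sup>-\<^sup>1 G\<^sub>n(x) / (p - n) = (x choose p - 1)\<close>. As \<open>1 / (p - n) \<equiv> - 1 / n\<close>, the
  terms with \<open>1 \<le> n \<le> p - 2\<close> sum to the component of \<open>\<gamma>\<^sup>M(x)\<close> at \<open>p\<close>, and only \<open>G\<^sub>p\<^sub>-\<^sub>1(x)\<close> remains
  to be found. Now \<open>G\<^sub>n(x)\<close> is the integral of \<open>(u choose n)\<close> over \<open>x \<le> u \<le> x + 1\<close>, and by Lagrange's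
  theorem \<open>(p - 1)! (u choose p - 1) = (u + 1)\<^sup>p\<^sup>-\<^sup>1 - 1 + p g(u)\<close> with \<open>g\<close> integral of degree less
  than \<open>p - 1\<close>, so that integrating \<open>g\<close> introduces no \<open>p\<close> in the denominators. Hence
  \<open>(p - 1)! G\<^sub>p\<^sub>-\<^sub>1(x) \<equiv> ((x + 2)\<^sup>p - (x + 1)\<^sup>p) / p - 1\<close>, and multiplying the identity by
  \<open>(p - 1)! = p W - 1\<close>, where \<open>W\<close> is the Wilson quotient, gives the claim modulo \<open>p\<close>.
\<close>

section \<open>Integrality and congruence at a prime\<close>

text \<open>The localisation of the integers at \<open>p\<close>, inside the rationals. Fractions
  need not be reduced, so closure proofs may simply multiply denominators.\<close>

definition p_int :: "nat \<Rightarrow> rat set" where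
  "p_int p = {of_int a / of_int b |a b. \<not> int p dvd b}"

text \<open>Only the difference has to lie in \<open>p\<close> times the local ring. Hence
  congruences can be stated between expressions with visible denominators \<open>p\<close> before
  these are known to be integral.\<close>

definition p_cong :: "nat \<Rightarrow> rat \<Rightarrow> rat \<Rightarrow> bool" where
  "p_cong p r s \<longleftrightarrow> (\<exists>c\<in>p_int p. r = s + of_nat p * c)"

lemma p_intI: "\<not> int p dvd b \<Longrightarrow> of_int a / of_int b \<in> p_int p"
  by (auto simp: p_int_def)

lemma p_int_of_int: "prime p \<Longrightarrow> of_int a \<in> p_int p"
  using p_intI[of p 1 a] by (auto simp: zdvd1_eq dest: prime_gt_1_nat)

lemma p_int_of_nat: "prime p \<Longrightarrow> of_nat a \<in> p_int p"
  using p_int_of_int[of p "int a"] by simp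

lemma p_int_0: "prime p \<Longrightarrow> 0 \<in> p_int p"
  using p_int_of_nat[of p 0] by simp

lemma p_int_1: "prime p \<Longrightarrow> 1 \<in> p_int p"
  using p_int_of_nat[of p 1] by simp

lemma p_int_add:
  assumes "prime p" "x \<in> p_int p" "y \<in> p_int p"
  shows "x + y \<in> p_int p"
proof -
  obtain a b c d where *: "x = of_int a / of_int b" "\<not> int p dvd b" "y = of_int c / of_int d" "\<not> int p dvd d"
    using assms by (auto simp: p_int_def)
  then have "b \<noteq> 0" "d \<noteq> 0" by auto
  with * have "x + y = of_int (a * d + c * b) / of_int (b * d)" by (simp add: field_simps)
  moreover have "\<not> int p dvd b * d" using * assms(1) by (simp add: prime_dvd_mult_iff)
  ultimately show ?thesis using p_intI by metis
qed

lemma p_int_mult: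
  assumes "prime p" "x \<in> p_int p" "y \<in> p_int p"
  shows "x * y \<in> p_int p"
proof -
  obtain a b c d where *: "x = of_int a / of_int b" "\<not> int p dvd b" "y = of_int c / of_int d" "\<not> int p dvd d"
    using assms by (auto simp: p_int_def)
  then have "x * y = of_int (a * c) / of_int (b * d)" by (simp add: field_simps)
  moreover have "\<not> int p dvd b * d" using * assms(1) by (simp add: prime_dvd_mult_iff)
  ultimately show ?thesis using p_intI by metis
qed

lemma p_int_minus: "prime p \<Longrightarrow> x \<in> p_int p \<Longrightarrow> - x \<in> p_int p"
  using p_int_mult[of p "- 1" x] p_int_of_int[of p "- 1"] by simp

lemma p_int_diff: "prime p \<Longrightarrow> x \<in> p_int p \<Longrightarrow> y \<in> p_int p \<Longrightarrow> x - y \<in> p_int p"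
  using p_int_add[of p x "- y"] p_int_minus[of p y] by simp

lemma p_int_sum: "prime p \<Longrightarrow> (\<And>i. i \<in> I \<Longrightarrow> f i \<in> p_int p) \<Longrightarrow> sum f I \<in> p_int p"
  by (induction I rule: infinite_finite_induct) (auto simp: p_int_0 p_int_add)

lemma p_int_prod: "prime p \<Longrightarrow> (\<And>i. i \<in> I \<Longrightarrow> f i \<in> p_int p) \<Longrightarrow> prod f I \<in> p_int p"
  by (induction I rule: infinite_finite_induct) (auto simp: p_int_1 p_int_mult)

lemma p_int_power: "prime p \<Longrightarrow> x \<in> p_int p \<Longrightarrow> x ^ n \<in> p_int p"
  by (induction n) (auto simp: p_int_1 p_int_mult)

lemma p_int_divide_int: "prime p \<Longrightarrow> x \<in> p_int p \<Longrightarrow> \<not> int p dvd b \<Longrightarrow> x / of_int b \<in> p_int p"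
  using p_int_mult[of p x "1 / of_int b"] p_intI[of p b 1] by simp

lemma p_int_divide_nat: "prime p \<Longrightarrow> x \<in> p_int p \<Longrightarrow> \<not> p dvd n \<Longrightarrow> x / of_nat n \<in> p_int p"
  using p_int_divide_int[of p x "int n"] by simp

lemmas p_int_intros = p_int_of_int p_int_of_nat p_int_0 p_int_1 p_int_add p_int_mult p_int_minus
  p_int_diff p_int_sum p_int_prod p_int_power

lemma p_congI: "c \<in> p_int p \<Longrightarrow> r - s = of_nat p * c \<Longrightarrow> p_cong p r s"
  unfolding p_cong_def by (rule bexI[of _ c]) auto

lemma p_cong_refl: "prime p \<Longrightarrow> p_cong p r r"
  by (rule p_congI[OF p_int_0]) auto

lemma p_cong_sym: "prime p \<Longrightarrow> p_cong p r s \<Longrightarrow> p_cong p s r"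
  by (auto simp: p_cong_def intro!: bexI[OF _ p_int_minus])

lemma p_cong_trans: "prime p \<Longrightarrow> p_cong p r s \<Longrightarrow> p_cong p s t \<Longrightarrow> p_cong p r t"
  by (auto simp: p_cong_def algebra_simps intro!: bexI[OF _ p_int_add])

lemma p_cong_add:
  assumes "prime p" "p_cong p r s" "p_cong p r' s'"
  shows "p_cong p (r + r') (s + s')"
proof -
  obtain c c' where "c \<in> p_int p" "c' \<in> p_int p" "r = s + of_nat p * c" "r' = s' + of_nat p * c'"
    using assms by (auto simp: p_cong_def)
  then show ?thesis
    by (intro p_congI[of "c + c'"] p_int_add assms(1)) (auto simp: algebra_simps)
qed

lemma p_cong_cmult:
  assumes "prime p" "p_cong p r s" "t \<in> p_int p"
  shows "p_cong p (t * r) (t * s)"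
proof -
  obtain c where "c \<in> p_int p" "r = s + of_nat p * c"
    using assms by (auto simp: p_cong_def)
  then show ?thesis
    by (intro p_congI[of "t * c"] p_int_mult assms) (auto simp: algebra_simps)
qed

lemma p_cong_minus: "prime p \<Longrightarrow> p_cong p r s \<Longrightarrow> p_cong p (- r) (- s)"
  using p_cong_cmult[of p r s "- 1"] p_int_of_int[of p "- 1"] by simp

lemma p_cong_diff:
  "prime p \<Longrightarrow> p_cong p r s \<Longrightarrow> p_cong p r' s' \<Longrightarrow> p_cong p (r - r') (s - s')"
  using p_cong_add[of p r s "- r'" "- s'"] p_cong_minus[of p r' s'] by simp

lemma p_cong_sum:
  "prime p \<Longrightarrow> (\<And>i. i \<in> I \<Longrightarrow> p_cong p (f i) (g i)) \<Longrightarrow> p_cong p (sum f I) (sum g I)"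
  by (induction I rule: infinite_finite_induct) (auto simp: p_cong_refl p_cong_add)

lemma p_cong_of_int:
  assumes "prime p" "[a = b] (mod int p)"
  shows "p_cong p (of_int a) (of_int b)"
proof -
  obtain k where k: "a = b + int p * k"
    using assms(2) by (metis cong_iff_lin cong_sym)
  show ?thesis
    unfolding k by (rule p_congI[of "of_int k"]) (auto intro: p_int_of_int assms(1))
qed

section \<open>Residues of p-integral rationals\<close>

lemma rat_mod_eqI:
  assumes p: "prime p" and c: "p_cong p r (of_int c)" "0 \<le> c" "c < int p"
  shows "rat_mod p r = c"
proof -
  obtain a b where ab: "\<not> int p dvd b" "r = of_int c + of_nat p * (of_int a / of_int b)"
    using c(1) unfolding p_cong_def p_int_def by blast
  then have "b \<noteq> 0" by auto
  with ab have "r = of_int (c * b + int p * a) / of_int b"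
    by (simp add: field_simps)
  moreover have "[c * b = c * b + int p * a] (mod int p)"
    by (simp add: cong_def)
  ultimately show ?thesis
    using rat_mod_unique[OF p ab(1) c(2,3)] by blast
qed

text \<open>The denominator is invertible modulo \<open>p\<close>, so \<open>rat_mod\<close> is the
  true residue here and not its junk value.\<close>

lemma rat_mod_p_cong:
  assumes p: "prime p" and r: "r \<in> p_int p"
  shows "p_cong p r (of_int (rat_mod p r))"
proof -
  obtain a b where ab: "\<not> int p dvd b" "r = of_int a / of_int b"
    using r by (auto simp: p_int_def)
  have "coprime b (int p)"
    using p ab(1) by (metis coprime_commute prime_imp_coprime prime_nat_int_transfer)
  then obtain y where y: "[b * y = 1] (mod int p)"
    using cong_solve_coprime_int by blast
  define c where "c = (a * y) mod int p"
  have pp: "int p > 0" using p prime_gt_0_nat by simp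
  have "[c * b = (a * y) * b] (mod int p)"
    unfolding c_def by (intro cong_mult cong_refl) (simp add: cong_def)
  also have "(a * y) * b = a * (b * y)" by (simp only: mult_ac)
  also have "[a * (b * y) = a * 1] (mod int p)" by (intro cong_mult cong_refl y)
  finally have cb: "[c * b = a] (mod int p)" by simp
  then have c: "rat_mod p r = c"
    unfolding ab(2) by (intro rat_mod_unique p ab(1)) (use pp in \<open>auto simp: c_def\<close>)
  obtain k where "a = c * b + int p * k"
    using cb by (metis cong_iff_lin cong_sym)
  moreover have "b \<noteq> 0" using ab(1) by auto
  ultimately show ?thesis
    unfolding c using ab
    by (intro p_congI[of "of_int k / of_int b"] p_intI) (auto simp: field_simps)
qed

lemma rat_mod_bounds: "prime p \<Longrightarrow> 0 \<le> rat_mod p r \<and> rat_mod p r < int p"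
  using prime_gt_0_nat by (simp add: rat_mod_def)

lemma rat_mod_cong:
  assumes p: "prime p" and rs: "p_cong p r s" and s: "s \<in> p_int p"
  shows "rat_mod p r = rat_mod p s"
  using rat_mod_bounds[OF p] rat_mod_eqI[OF p p_cong_trans[OF p rs rat_mod_p_cong[OF p s]]] by blast

section \<open>Equality and ring operations on classes of rational sequences\<close>

lemma A_of_eqI:
  assumes "\<forall>\<^sub>F p in sequentially. prime p \<longrightarrow> rat_mod p (r p) = rat_mod p (s p)"
  shows "A_of r = A_of s"
  using assms unfolding A_of_eq_iff cofinite_eq_sequentially[symmetric] eventually_cofinite
  by simp

text \<open>The operations of \<open>prime_prod\<close> produce integers reduced modulo
  \<open>p\<close>; this turns their cosets back into the form \<open>A_of\<close>.\<close>

lemma A_of_of_int: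
  "A_of (\<lambda>p. of_int (h p)) = prime_sum +>\<^bsub>prime_prod\<^esub> (\<lambda>p\<in>{p. prime p}. h p mod int p)"
proof -
  have "rat_mod p (of_int (h p)) = h p mod int p" if "prime p" for p
    using that prime_gt_0_nat by (intro rat_mod_eqI p_cong_of_int) (auto simp: cong_def)
  then show ?thesis unfolding A_of_def by (metis (no_types, lifting) mem_Collect_eq restrict_ext)
qed

abbreviation ae_p_int :: "(nat \<Rightarrow> rat) \<Rightarrow> bool" where
  "ae_p_int r \<equiv> \<forall>\<^sub>F p in sequentially. prime p \<longrightarrow> r p \<in> p_int p"

lemma A_of_coset:
  "A_of r = prime_sum +>\<^bsub>prime_prod\<^esub> (\<lambda>p\<in>{p. prime p}. rat_mod p (r p))"
  "(\<lambda>p\<in>{p. prime p}. rat_mod p (r p)) \<in> carrier prime_prod"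
  by (simp_all add: A_of_def rat_mod_def mod_in_prime_prod)

text \<open>The quotient map is a ring homomorphism, so the sum is the class of the sums of
  residues. Where both terms are integral, this agrees with the residue of the sum.\<close>

lemma A_of_add:
  assumes "ae_p_int r" "ae_p_int s"
  shows "A_of r \<oplus>\<^bsub>\<A>\<^esub> A_of s = A_of (\<lambda>p. r p + s p)"
proof -
  interpret ideal prime_sum prime_prod by (rule ideal_prime_sum)
  have "A_of r \<oplus>\<^bsub>\<A>\<^esub> A_of s = A_of (\<lambda>p. of_int (rat_mod p (r p) + rat_mod p (s p)))"
    unfolding A_of_of_int \<A>_def A_of_coset(1)
    by (subst ring_hom_add[OF rcos_ring_hom A_of_coset(2) A_of_coset(2), symmetric])
       (auto simp: prime_prod_sel intro!: arg_cong[where f = "a_r_coset _ _"] restrict_ext)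
  also have "\<dots> = A_of (\<lambda>p. r p + s p)"
  proof (rule A_of_eqI)
    show "\<forall>\<^sub>F p in sequentially. prime p \<longrightarrow>
        rat_mod p (of_int (rat_mod p (r p) + rat_mod p (s p))) = rat_mod p (r p + s p)"
      using assms
    proof (eventually_elim, intro impI)
      fix p assume *: "prime p \<longrightarrow> r p \<in> p_int p" "prime p \<longrightarrow> s p \<in> p_int p" "prime p"
      then show "rat_mod p (of_int (rat_mod p (r p) + rat_mod p (s p))) = rat_mod p (r p + s p)"
        by (intro rat_mod_cong) (auto intro!: p_cong_sym[OF _ p_cong_add] rat_mod_p_cong p_int_add)
    qed
  qed
  finally show ?thesis .
qed

text \<open>Follows from \<open>A_of_add\<close>: adding the class of \<open>s\<close> to that of
  \<open>r - s\<close> gives that of \<open>r\<close>, and \<open>A_of s\<close> cancels in the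
  ring.\<close>

lemma A_of_diff:
  assumes "ae_p_int r" "ae_p_int s"
  shows "A_of r \<ominus>\<^bsub>\<A>\<^esub> A_of s = A_of (\<lambda>p. r p - s p)"
proof -
  interpret I: ideal prime_sum prime_prod by (rule ideal_prime_sum)
  interpret A: cring \<A> by (rule cring_A)
  interpret P: cring prime_prod by (rule cring_prime_prod)
  have car: "A_of r \<in> carrier \<A>" for r
    unfolding \<A>_def A_of_coset(1)
    by (rule ring_hom_closed[OF I.rcos_ring_hom A_of_coset(2)])
  have ae: "ae_p_int (\<lambda>p. r p - s p)"
    using assms by eventually_elim (auto intro: p_int_diff)
  have "A_of (\<lambda>p. r p - s p) \<oplus>\<^bsub>\<A>\<^esub> A_of s = A_of r"
    by (subst A_of_add[OF ae assms(2)]) simp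
  then have "A_of r \<ominus>\<^bsub>\<A>\<^esub> A_of s = (A_of (\<lambda>p. r p - s p) \<oplus>\<^bsub>\<A>\<^esub> A_of s) \<ominus>\<^bsub>\<A>\<^esub> A_of s"
    by simp
  also have "\<dots> = A_of (\<lambda>p. r p - s p)"
    using car by (simp add: A.minus_eq A.a_assoc A.r_neg)
  finally show ?thesis .
qed

lemma A_of_one: "\<one>\<^bsub>\<A>\<^esub> = A_of (\<lambda>p. 1)"
proof -
  have "\<one>\<^bsub>\<A>\<^esub> = prime_sum +>\<^bsub>prime_prod\<^esub> (\<lambda>p\<in>{p. prime p}. 1 mod int p)"
    unfolding \<A>_def FactRing_def prime_prod_sel(4) monoid.select_convs
    by (auto intro!: arg_cong[where f = "a_r_coset _ _"] restrict_ext simp: mod_pos_pos_trivial dest!: prime_gt_1_nat)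
  then show ?thesis using A_of_of_int[of "\<lambda>_. 1"] by simp
qed

section \<open>Gregory polynomials as integrals\<close>

definition poly_integral :: "'a::field_char_0 poly \<Rightarrow> 'a poly" where
  "poly_integral f = (\<Sum>k\<le>degree f. monom (coeff f k / of_nat (Suc k)) (Suc k))"

lemma coeff_poly_integral:
  "coeff (poly_integral f) n = (if n = 0 then 0 else coeff f (n - 1) / of_nat n)"
proof (cases n)
  case 0
  then show ?thesis by (simp add: poly_integral_def coeff_sum)
next
  case (Suc m)
  have "coeff (poly_integral f) n = (\<Sum>k\<le>degree f. if k = m then coeff f m / of_nat (Suc m) else 0)"
    unfolding poly_integral_def coeff_sum Suc by (intro sum.cong) auto
  then show ?thesis by (auto simp: Suc coeff_eq_0)
qed

lemma pderiv_poly_integral: "pderiv (poly_integral f) = f"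
  by (rule poly_eqI) (simp add: coeff_pderiv coeff_poly_integral del: of_nat_Suc)

text \<open>The integral of \<open>f\<close> from \<open>x\<close> to \<open>x + 1\<close>, defined
  through a formal antiderivative so that it makes sense over the rationals.\<close>

definition unit_integral :: "'a::field_char_0 \<Rightarrow> 'a poly \<Rightarrow> 'a" where
  "unit_integral x f = poly (poly_integral f) (x + 1) - poly (poly_integral f) x"

text \<open>\<open>f\<close> and the antiderivative of its derivative differ by a constant, which
  cancels between the endpoints.\<close>

lemma unit_integral_pderiv: "unit_integral x (pderiv f) = poly f (x + 1) - poly f x"
proof -
  have "pderiv (f - poly_integral (pderiv f)) = 0"
    by (simp add: pderiv_diff pderiv_poly_integral)
  then obtain c where "f - poly_integral (pderiv f) = [:c:]"
    using pderiv_iszero by blast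
  then have "f = poly_integral (pderiv f) + [:c:]" by (simp add: algebra_simps)
  then have "poly f y = poly (poly_integral (pderiv f)) y + c" for y
    by (metis poly_add poly_pCons mult_zero_right poly_0 add.right_neutral)
  then show ?thesis by (simp add: unit_integral_def)
qed

lemma unit_integral_add: "unit_integral x (f + g) = unit_integral x f + unit_integral x g"
proof -
  have "poly_integral (f + g) = poly_integral f + poly_integral g"
    by (rule poly_eqI) (simp add: coeff_poly_integral add_divide_distrib)
  then show ?thesis by (simp add: unit_integral_def)
qed

lemma unit_integral_smult: "unit_integral x (smult c f) = c * unit_integral x f"
proof -
  have "poly_integral (smult c f) = smult c (poly_integral f)"
    by (rule poly_eqI) (simp add: coeff_poly_integral)
  then show ?thesis by (simp add: unit_integral_def algebra_simps)
qed

lemma unit_integral_sum: "unit_integral x (sum f I) = (\<Sum>i\<in>I. unit_integral x (f i))"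
proof (induction I rule: infinite_finite_induct)
  case (infinite A)
  then show ?case using unit_integral_smult[of x 0 0] by simp
next
  case empty
  then show ?case using unit_integral_smult[of x 0 0] by simp
qed (simp add: unit_integral_add)

section \<open>Binomial polynomials and their derivatives\<close>

definition binomial_poly :: "nat \<Rightarrow> rat poly" where
  "binomial_poly n = fps_nth one_plus_t_powr_x n"

lemma poly_binomial_poly: "poly (binomial_poly n) x = x gchoose n"
  by (simp add: binomial_poly_def poly_one_plus_t_powr_x)

text \<open>Only the factor \<open>u\<close> of the falling factorial vanishes at 0, so the
  derivative there is the product of the other factors over the factorial. The value is a
  coefficient of \<open>log (1 + t)\<close>.\<close>

lemma poly_pderiv_binomial_poly_0:
  "poly (pderiv (binomial_poly (Suc n))) 0 = (- 1) ^ n / of_nat (Suc n)"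
proof -
  define f :: "rat poly" where "f = (\<Prod>i<n. [:0, 1:] - of_nat (Suc i))"
  have "binomial_poly (Suc n) = smult (1 / fact (Suc n)) ([:0, 1:] * f)"
    unfolding binomial_poly_def one_plus_t_powr_x_def f_def fps_nth_Abs_fps
    by (subst prod.atLeast0_lessThan_Suc_shift) (simp add: atLeast0LessThan)
  then have "poly (pderiv (binomial_poly (Suc n))) 0 = poly f 0 / fact (Suc n)"
    by (simp add: pderiv_smult pderiv_mult pderiv_pCons del: fact_Suc)
  also have "poly f 0 = (- 1) ^ n * fact n"
    unfolding f_def poly_prod
    by (induction n) (auto simp: of_nat_poly algebra_simps)
  finally show ?thesis by (simp only: fact_Suc) simp
qed

lemma binomial_poly_0: "binomial_poly 0 = 1"
  by (simp add: binomial_poly_def one_plus_t_powr_x_def)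

text \<open>Pascal's rule, differentiated.\<close>

lemma pderiv_binomial_poly_shift:
  "poly (pderiv (binomial_poly (Suc n))) (x + 1) =
     poly (pderiv (binomial_poly (Suc n))) x + poly (pderiv (binomial_poly n)) x"
proof -
  have "pcompose (binomial_poly (Suc n)) [:1, 1:] = binomial_poly (Suc n) + binomial_poly n"
    by (rule poly_ext) (simp add: poly_pcompose poly_binomial_poly gbinomial_Suc_Suc add.commute)
  then have "pderiv (pcompose (binomial_poly (Suc n)) [:1, 1:]) =
      pderiv (binomial_poly (Suc n)) + pderiv (binomial_poly n)"
    by (simp add: pderiv_add)
  then have "poly (pcompose (pderiv (binomial_poly (Suc n))) [:1, 1:]) x =
      poly (pderiv (binomial_poly (Suc n))) x + poly (pderiv (binomial_poly n)) x"
    by (simp add: pderiv_pcompose pderiv_pCons flip: one_pCons)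
  then show ?thesis by (simp add: poly_pcompose add.commute)
qed

lemma poly_eqI_of_nat:
  fixes f g :: "'a :: {idom, ring_char_0} poly"
  assumes "\<And>m. poly f (of_nat m) = poly g (of_nat m)"
  shows "f = g"
proof (rule ccontr)
  assume "f \<noteq> g"
  then have "finite {x. poly (f - g) x = 0}"
    by (intro poly_roots_finite) simp
  moreover have "range of_nat \<subseteq> {x. poly (f - g) x = 0}"
    using assms by auto
  ultimately show False
    using finite_subset infinite_UNIV_char_0 finite_imageD[of of_nat "UNIV :: nat set"]
    by (metis infinite_UNIV_nat inj_of_nat)
qed

text \<open>The coefficient of \<open>t\<^sup>n\<close> in \<open>(d/dx) (1 + t)\<^sup>x = log (1 + t) (1 + t)\<^sup>x\<close>.\<close>
lemma pderiv_binomial_poly: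
  "pderiv (binomial_poly n) = (\<Sum>i\<le>n. smult (fps_nth (fps_ln 1) (n - i)) (binomial_poly i))"
proof (induction n)
  case 0
  then show ?case by (simp add: binomial_poly_0)
next
  case (Suc n)
  define E where "E n = (\<Sum>i\<le>n. smult (fps_nth (fps_ln 1) (n - i)) (binomial_poly i))" for n
  \<comment> \<open>The term \<open>i = 0\<close> is constant in \<open>x\<close>; Pascal's rule
    applies to each of the others.\<close>
  have shift: "poly (E (Suc n)) (x + 1) = poly (E (Suc n)) x + poly (E n) x" for x
    unfolding E_def sum.atMost_Suc_shift
    by (simp add: poly_sum poly_binomial_poly gbinomial_Suc_Suc add.commute[of 1 x] sum.distrib distrib_left del: sum.atMost_Suc)
  \<comment> \<open>By the hypothesis for \<open>n\<close>, both sides satisfy the same first-order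
    difference equation, and they agree at 0. So they agree at all naturals, hence as
    polynomials.\<close>
  have "poly (pderiv (binomial_poly (Suc n))) (of_nat m) = poly (E (Suc n)) (of_nat m)" for m
  proof (induction m)
    case 0
    show ?case
      unfolding E_def sum.atMost_Suc_shift
      by (simp add: poly_pderiv_binomial_poly_0 poly_sum poly_binomial_poly fps_ln_nth del: sum.atMost_Suc of_nat_Suc)
  next
    case (Suc m)
    have "poly (pderiv (binomial_poly (Suc n))) (of_nat m + 1) = poly (E (Suc n)) (of_nat m + 1)"
      unfolding shift pderiv_binomial_poly_shift using Suc \<open>pderiv (binomial_poly n) = _\<close>
      by (simp add: E_def)
    then show ?case by (simp add: add.commute)
  qed
  then show ?case unfolding E_def by (rule poly_eqI_of_nat)
qed

section \<open>Gregory polynomials as integrals of binomial polynomials\<close>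

lemma gregory_recurrence:
  "(\<Sum>i\<le>n. poly (gregory_poly i) x * fps_nth (fps_ln 1) (Suc n - i)) = x gchoose n"
proof -
  have "fps_nth (Abs_fps (\<lambda>n. poly (gregory_poly n) x) * fps_ln 1) (Suc n) =
      poly (fps_nth (Abs_fps gregory_poly * const_fps (fps_ln 1)) (Suc n)) x"
    unfolding fps_mult_nth poly_sum by (intro sum.cong) (simp_all add: const_fps_def)
  also have "\<dots> = x gchoose n"
    by (simp add: gregory_poly_gf poly_one_plus_t_powr_x)
  \<comment> \<open>The term \<open>i = Suc n\<close> drops out because \<open>log (1 + t)\<close>
    has no constant term.\<close>
  finally show ?thesis by (simp add: fps_mult_nth atLeast0AtMost)
qed

text \<open>The coefficient of \<open>t\<close> in \<open>log (1 + t)\<close> is 1, so the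
  recurrence determines its last unknown from the earlier ones without division.\<close>

lemma sum_fps_ln_nth_split:
  "(\<Sum>i\<le>n. f i * fps_nth (fps_ln 1) (Suc n - i)) =
     (\<Sum>i<n. f i * fps_nth (fps_ln 1) (Suc n - i)) + f n"
  by (simp add: fps_ln_nth flip: lessThan_Suc_atMost)

text \<open>The integrals satisfy \<open>gregory_recurrence\<close> too: integrating the derivative
  of \<open>binomial_poly (Suc n)\<close> gives a difference that Pascal's rule evaluates. The
  recurrence has a unique solution.\<close>

lemma gregory_poly_eq_unit_integral:
  "poly (gregory_poly n) x = unit_integral x (binomial_poly n)"
proof -
  have rec: "(\<Sum>i\<le>n. unit_integral x (binomial_poly i) * fps_nth (fps_ln 1) (Suc n - i)) = x gchoose n" for n
  proof -
    have "x gchoose n = (x + 1 gchoose Suc n) - (x gchoose Suc n)"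
      by (simp add: gbinomial_Suc_Suc)
    also have "\<dots> = unit_integral x (pderiv (binomial_poly (Suc n)))"
      by (simp add: unit_integral_pderiv poly_binomial_poly)
    also have "\<dots> = (\<Sum>i\<le>Suc n. fps_nth (fps_ln 1) (Suc n - i) * unit_integral x (binomial_poly i))"
      by (simp only: pderiv_binomial_poly unit_integral_sum unit_integral_smult)
    finally show ?thesis by (simp add: mult.commute)
  qed
  show ?thesis
  proof (induction n rule: less_induct)
    case (less n)
    have "(\<Sum>i<n. poly (gregory_poly i) x * fps_nth (fps_ln 1) (Suc n - i)) =
        (\<Sum>i<n. unit_integral x (binomial_poly i) * fps_nth (fps_ln 1) (Suc n - i))"
      using less by (intro sum.cong) auto
    then show ?case
      using gregory_recurrence[where n = n and x = x] rec[of n] unfolding sum_fps_ln_nth_split by simp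
  qed
qed

section \<open>Binomial polynomials modulo a prime\<close>

text \<open>Lagrange's theorem modulo a prime: a polynomial with more incongruent roots than its
  degree vanishes modulo \<open>p\<close>. The induction removes one root at a time by synthetic
  division.\<close>

lemma prime_dvd_poly_if_roots:
  fixes f :: "int poly" and p :: int
  assumes "prime p" "finite A" "degree f < card A"
    and "\<And>a b. a \<in> A \<Longrightarrow> b \<in> A \<Longrightarrow> p dvd a - b \<Longrightarrow> a = b"
    and "\<And>a. a \<in> A \<Longrightarrow> p dvd poly f a"
  shows "[:p:] dvd f"
  using assms(2-)
proof (induction "card A" arbitrary: A f)
  case 0
  then show ?case by simp
next
  case (Suc n)
  then obtain a where a: "a \<in> A" by fastforce
  define q where "q = synthetic_div f a"
  have f: "f = [:- a, 1:] * q + [:poly f a:]"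
    unfolding q_def by (rule synthetic_div_correct'[symmetric])
  have "[:p:] dvd q"
  \<comment> \<open>A constant \<open>f\<close> is treated apart because \<open>A - {a}\<close> may
    then be empty, and the degree bound for \<open>q\<close> would fail.\<close>
  proof (cases "degree f = 0")
    case True
    then have "q = 0" by (simp add: q_def synthetic_div_eq_0_iff)
    then show ?thesis by simp
  next
    case False
    show ?thesis
    proof (rule Suc.hyps(1)[of "A - {a}"])
      show "n = card (A - {a})" using Suc.hyps(2) a by simp
      then show "degree q < card (A - {a})"
        using Suc.hyps(2) Suc.prems(2) False by (simp add: q_def degree_synthetic_div)
      fix b assume b: "b \<in> A - {a}"
      have "poly f b = (b - a) * poly q b + poly f a"
        by (subst f) (simp add: algebra_simps)
      then have "p dvd (b - a) * poly q b"
        using Suc.prems(4) a b by (metis DiffD1 dvd_add_left_iff)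
      moreover have "\<not> p dvd b - a" using Suc.prems(3)[of b a] a b by auto
      ultimately show "p dvd poly q b" using assms(1) by (simp add: prime_dvd_mult_iff)
    qed (use Suc.prems in auto)
  qed
  moreover have "[:p:] dvd [:poly f a:]"
    using Suc.prems(4)[OF a] by (simp add: const_poly_dvd_iff coeff_pCons split: nat.splits)
  ultimately show ?case by (subst f) (intro dvd_add dvd_mult)
qed

lemma fermat_theorem_int:
  assumes "prime p" "\<not> int p dvd a"
  shows "[a ^ (p - 1) = 1] (mod int p)"
proof -
  have p: "int p > 0" using assms(1) prime_gt_0_nat by simp
  define b where "b = nat (a mod int p)"
  have b: "int b = a mod int p" unfolding b_def using p by simp
  have "\<not> p dvd b"
    using assms(2) b by (metis dvd_mod_iff dvd_refl int_dvd_int_iff)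
  then have "[int b ^ (p - 1) = 1] (mod int p)"
    using fermat_theorem[OF assms(1)] cong_int_iff[of "b ^ (p - 1)" 1 p] by simp
  moreover have "[a ^ (p - 1) = int b ^ (p - 1)] (mod int p)"
    unfolding b by (intro cong_pow) (simp add: cong_def)
  ultimately show ?thesis using cong_trans by blast
qed

text \<open>Both products are monic of degree \<open>p - 1\<close>, so their difference has smaller
  degree, also after adding 1. It vanishes modulo \<open>p\<close> at \<open>p - 1\<close>
  incongruent points by Fermat's theorem, and Lagrange's theorem applies.\<close>

lemma falling_factorial_poly_mod_prime:
  assumes p: "prime p"
  obtains g :: "int poly" where
    "(\<Prod>i<p - 1. [:- int i, 1:]) = [:1, 1:] ^ (p - 1) - 1 + smult (int p) g" "degree g < p - 1"
proof -
  have p1: "p - 1 > 0" using prime_gt_1_nat[OF p] by simp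
  define F where "F = (\<Prod>i<p - 1. [:- int i, 1:])"
  define f where "f = F - ([:1, 1:] ^ (p - 1) - 1)"
  have F: "degree F = p - 1" "coeff F (p - 1) = 1"
  proof -
    show "degree F = p - 1" unfolding F_def by (subst degree_prod_eq_sum_degree) auto
    moreover have "lead_coeff F = 1" unfolding F_def lead_coeff_prod by simp
    ultimately show "coeff F (p - 1) = 1" by simp
  qed
  have G: "degree ([:1, 1 :: int:] ^ (p - 1)) = p - 1" "coeff ([:1, 1 :: int:] ^ (p - 1)) (p - 1) = 1"
  by (rule degree_linear_power coeff_linear_power)+
  have deg: "degree f < p - 1"
  proof -
    have "degree f \<le> p - 1"
      unfolding f_def by (intro degree_diff_le) (use F G in auto)
    moreover have "coeff f (p - 1) = 0"
      unfolding f_def using F G p1 by (simp add: coeff_1)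
    ultimately show ?thesis using p1
      by (metis degree_0 leading_coeff_0_iff le_neq_implies_less)
  qed
  have "[:int p:] dvd f"
  \<comment> \<open>The residue \<open>p - 1\<close> is left out: there \<open>1 + a\<close> is
    divisible by \<open>p\<close> and Fermat's theorem does not apply.\<close>
  proof (rule prime_dvd_poly_if_roots[where A = "int ` {..<p - 1}"])
    show "degree f < card (int ` {..<p - 1})" using deg by (simp add: card_image)
    fix a assume "a \<in> int ` {..<p - 1}"
    then obtain i where i: "a = int i" "i < p - 1" by auto
    have "poly F a = 0" unfolding F_def poly_prod using i by (intro prod_zero) auto
    then have "poly f a = 1 - (1 + a) ^ (p - 1)"
      unfolding f_def by simp
    moreover have "\<not> int p dvd 1 + a"
      using i zdvd_not_zless[of "1 + a" "int p"] by auto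
    ultimately show "int p dvd poly f a"
      using fermat_theorem_int[OF p] by (metis cong_iff_dvd_diff cong_sym)
  next
    fix a b assume *: "a \<in> int ` {..<p - 1}" "b \<in> int ` {..<p - 1}" "int p dvd a - b"
    then have "\<bar>a - b\<bar> < int p" by auto
    with *(3) show "a = b" using dvd_imp_le_int[of "a - b" "int p"] by force
  qed (use p in auto)
  then obtain g where g: "f = [:int p:] * g" by blast
  have "degree f = degree g" using g p by (simp add: prime_gt_0_nat)
  with deg g show thesis
    by (intro that[of g]) (auto simp: f_def F_def algebra_simps)
qed

lemma p_int_poly:
  fixes g :: "rat poly"
  assumes "prime p" "\<And>i. coeff g i \<in> p_int p" "x \<in> p_int p"
  shows "poly g x \<in> p_int p"
  unfolding poly_altdef by (intro p_int_intros assms)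

text \<open>The integer identity carried over to rational coefficients by comparing values at all
  naturals.\<close>

lemma binomial_poly_mod_prime:
  assumes p: "prime p"
  obtains g :: "rat poly" where
    "smult (fact (p - 1)) (binomial_poly (p - 1)) = [:1, 1:] ^ (p - 1) - 1 + smult (of_nat p) g"
    "degree g < p - 1" "\<And>i. coeff g i \<in> p_int p"
proof -
  obtain g :: "int poly" where
    g: "(\<Prod>i<p - 1. [:- int i, 1:]) = [:1, 1:] ^ (p - 1) - 1 + smult (int p) g" "degree g < p - 1"
    using falling_factorial_poly_mod_prime[OF p] .
  define g' :: "rat poly" where "g' = map_poly of_int g"
  have g': "poly g' (of_int m) = of_int (poly g m)" for m
    by (simp add: g'_def poly_altdef coeff_map_poly degree_map_poly)
  show thesis
  proof (rule that)
    show "coeff g' i \<in> p_int p" for i using p by (simp add: g'_def coeff_map_poly p_int_of_int)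
    show "degree g' < p - 1" using g(2) by (simp add: g'_def degree_map_poly)
    show "smult (fact (p - 1)) (binomial_poly (p - 1)) = [:1, 1:] ^ (p - 1) - 1 + smult (of_nat p) g'"
    proof (rule poly_eqI_of_nat)
      fix m :: nat
      have "of_int (poly (\<Prod>i<p - 1. [:- int i, 1:]) (int m)) =
        (of_int (poly ([:1, 1:] ^ (p - 1) - 1 + smult (int p) g) (int m)) :: rat)"
        by (simp only: g(1))
      then show "poly (smult (fact (p - 1)) (binomial_poly (p - 1))) (of_nat m) =
          poly ([:1, 1:] ^ (p - 1) - 1 + smult (of_nat p) g') (of_nat m :: rat)"
        using g'[of "int m"]
        by (simp add: poly_binomial_poly gbinomial_prod_rev poly_prod atLeast0LessThan)
    qed
  qed
qed

section \<open>The congruence for a single prime\<close>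

lemma p_int_fps_ln_nth:
  assumes "prime p" "n < p"
  shows "fps_nth (fps_ln 1) n \<in> p_int p"
proof (cases "n = 0")
  case True
  then show ?thesis using assms by (simp add: p_int_0)
next
  case False
  then have "\<not> p dvd n" using assms(2) by (auto dest: dvd_imp_le)
  moreover have "(- 1) ^ (n - 1) \<in> p_int p"
    using p_int_of_int[OF assms(1), of "- 1"] by (intro p_int_power assms(1)) simp
  ultimately show ?thesis
    using False p_int_divide_nat[OF assms(1)] by (simp add: fps_ln_nth)
qed

lemma p_int_gbinomial:
  assumes "prime p" "x \<in> p_int p" "n < p"
  shows "x gchoose n \<in> p_int p"
proof -
  have "\<not> p dvd fact n" using assms by (simp add: prime_dvd_fact_iff)
  then show ?thesis
    using p_int_divide_nat[OF assms(1), of "\<Prod>i = 0..<n. x - of_nat i" "fact n"] assms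
    by (auto simp: gbinomial_prod_rev intro!: p_int_intros)
qed

text \<open>The recurrence for index \<open>n\<close> uses coefficients of
  \<open>log (1 + t)\<close> only up to index \<open>n + 1\<close>, which stay integral below
  \<open>p\<close>. At \<open>n = p - 1\<close> the denominator \<open>p\<close> would
  enter.\<close>

lemma p_int_gregory_poly:
  assumes p: "prime p" and x: "x \<in> p_int p"
  shows "Suc n < p \<Longrightarrow> poly (gregory_poly n) x \<in> p_int p"
proof (induction n rule: less_induct)
  case (less n)
  have "poly (gregory_poly n) x =
      (x gchoose n) - (\<Sum>i<n. poly (gregory_poly i) x * fps_nth (fps_ln 1) (Suc n - i))"
    using gregory_recurrence[where n = n and x = x] unfolding sum_fps_ln_nth_split by simp
  also have "\<dots> \<in> p_int p"
    using less p x
    by (intro p_int_diff p_int_sum p_int_mult p_int_gbinomial p_int_fps_ln_nth) auto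
  finally show ?case .
qed

text \<open>Integration divides the coefficient of index \<open>k\<close> by \<open>k + 1\<close>,
  which the degree bound keeps below \<open>p\<close>.\<close>

lemma p_int_unit_integral:
  assumes p: "prime p" and x: "x \<in> p_int p" and g: "degree g < p - 1" "\<And>i. coeff g i \<in> p_int p"
  shows "unit_integral x g \<in> p_int p"
proof -
  have "poly (poly_integral g) y = (\<Sum>k\<le>degree g. coeff g k / of_nat (Suc k) * y ^ Suc k)" for y
    unfolding poly_integral_def poly_sum poly_monom ..
  moreover have "\<not> p dvd Suc k" if "k \<le> degree g" for k
    using that g(1) by (auto dest!: dvd_imp_le)
  ultimately show ?thesis
    unfolding unit_integral_def using p x g(2)
    by (auto intro!: p_int_intros p_int_divide_nat simp del: of_nat_Suc power_Suc)
qed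

lemma unit_integral_1: "unit_integral x 1 = 1"
  using unit_integral_pderiv[of x "[:0, 1:]"] by (simp add: pderiv_pCons flip: one_pCons)

lemma unit_integral_linear_power:
  assumes "n > 0"
  shows "unit_integral x ([:1, 1:] ^ (n - 1)) = ((x + 2) ^ n - (x + 1) ^ n) / of_nat n"
proof -
  have "of_nat n * unit_integral x ([:1, 1:] ^ (n - 1)) = (x + 2) ^ n - (x + 1) ^ n"
    using unit_integral_pderiv[of x "[:1, 1:] ^ n"]
    by (simp add: pderiv_power pderiv_pCons unit_integral_smult add_ac flip: one_pCons)
  then show ?thesis using assms by (simp add: field_simps)
qed

lemma p_int_wilson_quotient:
  assumes "prime p"
  shows "(fact (p - 1) + 1) / of_nat p \<in> p_int p"
proof -
  have "[fact (p - 1) = (- 1 :: int)] (mod int p)" using wilson_theorem[OF assms] .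
  then obtain k where "fact (p - 1) + 1 = int p * k"
    by (auto simp: cong_iff_dvd_diff)
  then have "(fact (p - 1) + 1 :: rat) = of_nat p * of_int k"
    by (metis of_int_1 of_int_add of_int_fact of_int_mult of_int_of_nat_eq)
  then show ?thesis using assms by (simp add: p_int_of_int prime_gt_0_nat)
qed

text \<open>The power \<open>(x + 1) ^ (p - 1)\<close> is kept exact, since its residue depends on
  whether \<open>p\<close> divides the numerator of \<open>x + 1\<close>. The case distinction is
  left to the passage to \<open>\<A>\<close>.\<close>

lemma sum_gregory_poly_mod_prime:
  assumes p: "prime p" "p > 2" and x: "x \<in> p_int p"
  shows "p_cong p (\<Sum>n = 1..p - 2. (- 1) ^ (n - 1) * poly (gregory_poly n) x / of_nat n)
    ((fact (p - 1) + 1) / of_nat p + ((x + 2) ^ p - (x + 1) ^ p - 1) / of_nat p - (x + 1) ^ (p - 1))"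
    (is "p_cong p ?R (?W + ?Q - ?y)")
proof -
  let ?P = "of_nat p :: rat" and ?F = "fact (p - 1) :: rat" and ?G = "\<lambda>n. poly (gregory_poly n) x"
  define S where "S = (\<Sum>n = 1..p - 2. ?G n * fps_nth (fps_ln 1) (p - n))"
  have P: "?P \<noteq> 0" using p by simp
  have "odd p" using p prime_odd_nat by blast
  have 1: "p_cong p S ?R"
    unfolding S_def
  proof (rule p_cong_sum[OF p(1)])
    fix n assume n: "n \<in> {1..p - 2}"
    have ln: "fps_nth (fps_ln 1) (p - n) = - ((- 1) ^ (n - 1)) / (?P - of_nat n)"
    proof -
      \<comment> \<open>The exponents \<open>p - n - 1\<close> and \<open>n - 1\<close> add up to
        the odd number \<open>p - 2\<close>.\<close>
      have "even (p - n - 1) \<longleftrightarrow> odd (n - 1)" using \<open>odd p\<close> n p(2) by auto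
      then have "(- 1 :: rat) ^ (p - n - 1) = - ((- 1) ^ (n - 1))"
        by (cases "even (n - 1)") auto
      moreover have "n < p" using n p(2) by auto
      ultimately show ?thesis by (simp add: fps_ln_nth of_nat_diff)
    qed
    have nz: "of_nat n \<noteq> (0 :: rat)" "?P - of_nat n \<noteq> 0" using n p(2) by auto
    show "p_cong p (?G n * fps_nth (fps_ln 1) (p - n)) ((- 1) ^ (n - 1) * ?G n / of_nat n)"
    \<comment> \<open>The factor \<open>p\<close> comes from
      \<open>1 / (p - n) + 1 / n = p / (n * (p - n))\<close>.\<close>
    proof (rule p_congI)
      have "\<not> p dvd n" "\<not> p dvd p - n" using n p(2) by (auto dest!: dvd_imp_le)
      moreover have "?G n * (- 1) ^ (n - 1) * of_int (- 1) \<in> p_int p"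
        using n p by (intro p_int_mult p_int_gregory_poly x p_int_power p_int_of_int)
          (use p_int_of_int[OF p(1), of "- 1"] in auto)
      ultimately show "?G n * (- 1) ^ (n - 1) * of_int (- 1) / of_nat n / of_nat (p - n) \<in> p_int p"
        by (intro p_int_divide_nat p(1))
      show "?G n * fps_nth (fps_ln 1) (p - n) - (- 1) ^ (n - 1) * ?G n / of_nat n =
        ?P * (?G n * (- 1) ^ (n - 1) * of_int (- 1) / of_nat n / of_nat (p - n))"
        unfolding ln using n p(2) nz by (simp add: of_nat_diff) (simp add: field_simps)
    qed
  qed
  \<comment> \<open>\<open>S\<close> is the recurrence sum at index \<open>p - 1\<close> without its
    end terms: \<open>i = 0\<close> contributes \<open>1 / p\<close>, with positive sign as
    \<open>p\<close> is odd, and \<open>i = p - 1\<close> contributes the last Gregory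
    value.\<close>
  have 2: "S = (x gchoose (p - 1)) - 1 / ?P - ?G (p - 1)"
  proof -
    have "{..p - 1} = insert 0 (insert (p - 1) {1..p - 2})" using p(2) by auto
    then have "(\<Sum>i\<le>p - 1. ?G i * fps_nth (fps_ln 1) (p - i)) =
        ?G 0 * fps_nth (fps_ln 1) p + ?G (p - 1) * fps_nth (fps_ln 1) (p - (p - 1)) + S"
      unfolding S_def using p(2) by (simp only:) (subst sum.insert, auto)+
    moreover have "?G 0 = 1" using gregory_recurrence[where n = 0 and x = x] by (simp add: fps_ln_nth)
    moreover have "fps_nth (fps_ln 1) p = 1 / ?P" using \<open>odd p\<close> p(2) by (simp add: fps_ln_nth)
    moreover have "fps_nth (fps_ln 1) (p - (p - 1)) = (1 :: rat)" using p(2) by (simp add: fps_ln_nth)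
    ultimately show ?thesis
      using gregory_recurrence[where n = "p - 1" and x = x] p(2) by simp
  qed
  obtain g where g: "smult ?F (binomial_poly (p - 1)) = [:1, 1:] ^ (p - 1) - 1 + smult ?P g"
      "degree g < p - 1" "\<And>i. coeff g i \<in> p_int p"
    using binomial_poly_mod_prime[OF p(1)] by blast
  have 3: "?F * ?G (p - 1) = ?Q + 1 / ?P - 1 + ?P * unit_integral x g"
  proof -
    \<comment> \<open>The constant 1 is moved to the left so that additivity of the integral
      suffices.\<close>
    have "?F * ?G (p - 1) + unit_integral x 1 = unit_integral x (smult ?F (binomial_poly (p - 1)) + 1)"
      by (simp only: gregory_poly_eq_unit_integral unit_integral_add unit_integral_smult)
    also have "\<dots> = unit_integral x ([:1, 1:] ^ (p - 1) + smult ?P g)"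
      unfolding g(1) by simp
    also have "\<dots> = ((x + 2) ^ p - (x + 1) ^ p) / ?P + ?P * unit_integral x g"
      using p(2) unit_integral_linear_power[of p x] by (simp add: unit_integral_add unit_integral_smult)
    finally show ?thesis by (simp add: unit_integral_1 diff_divide_distrib)
  qed
  have 4: "?F * (x gchoose (p - 1)) = ?y - 1 + ?P * poly g x"
    using arg_cong[OF g(1), of "\<lambda>f. poly f x"] by (simp add: poly_binomial_poly add.commute)
  have S: "S \<in> p_int p"
    unfolding S_def using p by (intro p_int_intros p_int_gregory_poly x p_int_fps_ln_nth) auto
  have "p_cong p S (?W + ?Q - ?y)"
  proof (rule p_congI)
    \<comment> \<open>The witness is found by solving the identity for
      \<open>(?P * ?W - 1) * S\<close> below for \<open>S\<close> and collecting the multiples of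
      \<open>?P\<close>.\<close>
    show "?W * S + unit_integral x g - poly g x \<in> p_int p"
      using p(1) x g by (intro p_int_intros p_int_wilson_quotient S p_int_unit_integral p_int_poly)
    have FP: "?F = ?P * ?W - 1" using P by simp
    have "?F * S = ?F * (x gchoose (p - 1)) - ?F / ?P - ?F * ?G (p - 1)"
      unfolding 2 by (simp add: right_diff_distrib)
    \<comment> \<open>This \<open>1 / ?P\<close> cancels against the one in fact
      \<open>3\<close>.\<close>
    also have "?F / ?P = ?W - 1 / ?P" by (simp add: add_divide_distrib)
    finally have "(?P * ?W - 1) * S = ?y - ?W - ?Q + ?P * (poly g x - unit_integral x g)"
      unfolding 3 4 unfolding FP[symmetric] by (simp add: algebra_simps)
    then show "S - (?W + ?Q - ?y) = ?P * (?W * S + unit_integral x g - poly g x)"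
      by (simp add: algebra_simps)
  qed
  then show ?thesis using 1 p_cong_sym[OF p(1)] p_cong_trans[OF p(1)] by blast
qed

section \<open>Passage to \<open>\<A>\<close>\<close>

lemma eventually_p_int: "\<forall>\<^sub>F p in sequentially. x \<in> p_int p"
proof -
  obtain a b where ab: "quotient_of x = (a, b)" by fastforce
  have "b > 0" "x = of_int a / of_int b"
    using quotient_of_denom_pos[OF ab] quotient_of_div[OF ab] by auto
  show ?thesis
    using eventually_gt_at_top[of "nat b"]
  proof eventually_elim
    case (elim p)
    then have "\<not> int p dvd b" using \<open>b > 0\<close> by (auto dest!: zdvd_imp_le)
    then show ?case unfolding \<open>x = _\<close> by (rule p_intI)
  qed
qed

section \<open>Fermat's theorem and Fermat quotients for p-integral rationals\<close>

lemma fermat_p_int: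
  assumes p: "prime p" and ab: "\<not> int p dvd a" "\<not> int p dvd b"
  shows "p_cong p ((of_int a / of_int b) ^ (p - 1)) 1"
proof -
  have "[a ^ (p - 1) = b ^ (p - 1)] (mod int p)"
    using fermat_theorem_int[OF p] ab by (meson cong_sym cong_trans)
  then obtain k where k: "a ^ (p - 1) = b ^ (p - 1) + int p * k"
    by (metis cong_iff_lin cong_sym)
  have k': "(of_int a ^ (p - 1) :: rat) = of_int b ^ (p - 1) + of_nat p * of_int k"
    using arg_cong[OF k, of "of_int :: int \<Rightarrow> rat"] by simp
  have "\<not> int p dvd b ^ (p - 1)" using p ab(2) prime_dvd_power by (meson prime_nat_int_transfer)
  moreover have "b \<noteq> 0" using ab by auto
  ultimately show ?thesis
    using k' by (intro p_congI[OF p_intI]) (auto simp: power_divide field_simps)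
qed

text \<open>In \<open>x * (x ^ (p - 1) - 1)\<close> the factor \<open>p\<close> comes from
  \<open>x\<close> if \<open>p\<close> divides the numerator, and otherwise from the second factor
  by Fermat's theorem.\<close>

lemma p_int_fermat_quotient:
  assumes p: "prime p" and x: "x \<in> p_int p"
  shows "(x ^ p - x) / of_nat p \<in> p_int p"
proof -
  obtain a b where ab: "x = of_int a / of_int b" "\<not> int p dvd b" using x by (auto simp: p_int_def)
  have P: "of_nat p \<noteq> (0 :: rat)" using p by auto
  have xp: "x ^ p = x ^ (p - 1) * x" using p by (metis power_minus_mult prime_gt_0_nat)
  show ?thesis
  proof (cases "int p dvd a")
    case True
    then obtain k where "a = int p * k" by blast
    then have "x = of_nat p * (of_int k / of_int b)" using ab by simp
    then have "(x ^ p - x) / of_nat p = (x ^ (p - 1) - 1) * (of_int k / of_int b)"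
      unfolding xp using P by (metis left_diff_distrib mult.left_commute mult_1 nonzero_mult_div_cancel_left)
    moreover have "of_int k / of_int b \<in> p_int p" using ab(2) by (rule p_intI)
    ultimately show ?thesis using p x by (simp only:) (intro p_int_intros)
  next
    case False
    obtain c where "c \<in> p_int p" "x ^ (p - 1) = 1 + of_nat p * c"
      using fermat_p_int[OF p False ab(2)] unfolding ab(1) p_cong_def by blast
    then have "(x ^ p - x) / of_nat p = c * x" unfolding xp using P by (simp add: field_simps)
    then show ?thesis using \<open>c \<in> p_int p\<close> p x by (simp add: p_int_mult)
  qed
qed

text \<open>A prime larger than both the denominator and the absolute value of the nonzero numerator
  divides neither.\<close>

lemma eventually_fermat_p_int:
  assumes "x \<noteq> 0"
  shows "\<forall>\<^sub>F p in sequentially. prime p \<longrightarrow> p_cong p (x ^ (p - 1)) 1"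
proof -
  obtain a b where ab: "quotient_of x = (a, b)" by fastforce
  have *: "b > 0" "x = of_int a / of_int b"
    using quotient_of_denom_pos[OF ab] quotient_of_div[OF ab] by auto
  with assms have "a \<noteq> 0" by auto
  show ?thesis
    using eventually_gt_at_top[of "nat b"] eventually_gt_at_top[of "nat \<bar>a\<bar>"]
  proof eventually_elim
    case (elim p)
    then have "\<not> int p dvd b" "\<not> int p dvd a"
      using \<open>b > 0\<close> \<open>a \<noteq> 0\<close> dvd_imp_le_int[of a "int p"] zdvd_imp_le[of "int p" b] by linarith+
    then show ?case unfolding *(2) using fermat_p_int by blast
  qed
qed

lemma ae_p_int_wilson_quotient: "ae_p_int (\<lambda>p. (fact (p - 1) + 1) / of_nat p)"
  by (intro always_eventually allI impI p_int_wilson_quotient)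

lemma ae_p_int_fermat_quotient: "ae_p_int (\<lambda>p. (x ^ p - x) / of_nat p)"
  using eventually_p_int[of x] by eventually_elim (simp add: p_int_fermat_quotient)

lemma ae_p_int_const: "ae_p_int (\<lambda>p. x)"
  using eventually_p_int[of x] by eventually_elim simp

lemma ae_p_int_add:
  assumes "ae_p_int r" "ae_p_int s"
  shows "ae_p_int (\<lambda>p. r p + s p)"
  using assms by eventually_elim (auto intro: p_int_add)

lemma ae_p_int_diff:
  assumes "ae_p_int r" "ae_p_int s"
  shows "ae_p_int (\<lambda>p. r p - s p)"
  using assms by eventually_elim (auto intro: p_int_diff)

lemmas ae_p_int_intros = ae_p_int_add ae_p_int_diff ae_p_int_const
  ae_p_int_wilson_quotient ae_p_int_fermat_quotient

text \<open>Collects the right side of the theorem into one sequence, so that a congruence at almost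
  all primes suffices.\<close>

lemma gamma_M_eq_A_of:
  "gamma_M x = A_of (\<lambda>p. (fact (p - 1) + 1) / of_nat p + ((x + 2) ^ p - (x + 2)) / of_nat p
     - ((x + 1) ^ p - (x + 1)) / of_nat p + indicator {-1} x - 1)"
  (is "_ = A_of ?s")
  unfolding gamma_M_def
proof (rule A_of_eqI)
  \<comment> \<open>The source of the indicator: the power is 0 for \<open>x = - 1\<close>, and
    congruent to 1 at almost all primes otherwise.\<close>
  have delta: "\<forall>\<^sub>F p in sequentially. prime p \<longrightarrow> p_cong p ((x + 1) ^ (p - 1)) (1 - indicator {-1} x)"
  proof (cases "x = - 1")
    case True
    have "(x + 1) ^ (p - 1) = 1 - indicator {-1} x" if "prime p" for p
      using True prime_gt_1_nat[OF that] by (simp add: zero_power)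
    then show ?thesis by (simp add: p_cong_refl)
  next
    case False
    then have "x + 1 \<noteq> 0" by (simp add: add_eq_0_iff2)
    then show ?thesis using eventually_fermat_p_int[of "x + 1"] False by simp
  qed
  have "ae_p_int ?s" by (intro ae_p_int_intros)
  then show "\<forall>\<^sub>F p in sequentially. prime p \<longrightarrow> rat_mod p
      (\<Sum>n = 1..p - 2. (- 1) ^ (n - 1) * poly (gregory_poly n) x / of_nat n) = rat_mod p (?s p)"
    using delta eventually_p_int[of x] eventually_gt_at_top[of 2]
  proof eventually_elim
    case (elim p)
    show ?case
    proof
      assume p: "prime p"
      \<comment> \<open>The linear parts of the two Fermat quotients combine to
        \<open>- (x + 2) + (x + 1) = - 1\<close>.\<close>
      have "?s p = (fact (p - 1) + 1) / of_nat p + ((x + 2) ^ p - (x + 1) ^ p - 1) / of_nat p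
          - (1 - indicator {-1} x)"
        by (simp add: add_divide_distrib diff_divide_distrib)
      moreover have "p_cong p ((fact (p - 1) + 1) / of_nat p + ((x + 2) ^ p - (x + 1) ^ p - 1) / of_nat p
            - (x + 1) ^ (p - 1)) ((fact (p - 1) + 1) / of_nat p
            + ((x + 2) ^ p - (x + 1) ^ p - 1) / of_nat p - (1 - indicator {-1} x))"
        using elim p by (intro p_cong_diff p_cong_refl) auto
      ultimately have "p_cong p (\<Sum>n = 1..p - 2. (- 1) ^ (n - 1) * poly (gregory_poly n) x / of_nat n) (?s p)"
        using p_cong_trans[OF p sum_gregory_poly_mod_prime[OF p elim(4,3)]] by (simp only:)
      then show "rat_mod p (\<Sum>n = 1..p - 2. (- 1) ^ (n - 1) * poly (gregory_poly n) x / of_nat n)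
          = rat_mod p (?s p)"
        using elim p by (intro rat_mod_cong) auto
    qed
  qed
qed

theorem theorem3p4:
  shows "(\<forall>x::rat. gamma_M x =
           gamma_W \<oplus>\<^bsub>\<A>\<^esub> ell_A (x + 2) \<ominus>\<^bsub>\<A>\<^esub> ell_A (x + 1)
             \<oplus>\<^bsub>\<A>\<^esub> A_of_rat (indicator {-1} x) \<ominus>\<^bsub>\<A>\<^esub> \<one>\<^bsub>\<A>\<^esub>)
         \<and> gamma_M (-1) = gamma_W"
proof (intro conjI allI)
  fix x :: rat
  show "gamma_M x =
           gamma_W \<oplus>\<^bsub>\<A>\<^esub> ell_A (x + 2) \<ominus>\<^bsub>\<A>\<^esub> ell_A (x + 1)
             \<oplus>\<^bsub>\<A>\<^esub> A_of_rat (indicator {-1} x) \<ominus>\<^bsub>\<A>\<^esub> \<one>\<^bsub>\<A>\<^esub>"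
    unfolding gamma_M_eq_A_of gamma_W_def ell_A_def A_of_rat_def A_of_one
    \<comment> \<open>The ring operations fold into a single sequence; almost-everywhere integrality
      of each partial result justifies every fold.\<close>
    by (simp only: A_of_add A_of_diff ae_p_int_intros)
next
  show "gamma_M (-1) = gamma_W"
    unfolding gamma_M_eq_A_of gamma_W_def
  proof (rule A_of_eqI, intro always_eventually allI impI)
    fix p :: nat assume "prime p"
    then have "p > 0" by (rule prime_gt_0_nat)
    \<comment> \<open>The Fermat quotients of 1 and 0 vanish, the latter as \<open>p > 0\<close>,
      and the indicator cancels the final 1.\<close>
    then show "rat_mod p ((fact (p - 1) + 1) / of_nat p + ((- 1 + 2) ^ p - (- 1 + 2)) / of_nat p
        - ((- 1 + 1) ^ p - (- 1 + 1)) / of_nat p + indicator {- 1} (- 1 :: rat) - 1) =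
        rat_mod p ((fact (p - 1) + 1) / of_nat p)"
      by (simp add: zero_power)
  qed
qed

end
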